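(* For every propositional modal formula $\varphi$: $\mathsf{KTB}\vdash\varphi$ if and only if $M_{B,W,T}\models\varphi$ for all complete Boolean algebras $B$, all nonempty sets $W\subseteq B^+$, and all $B$-translations $T$.
   Context: Modal logic. The propositional modal language has a countable set $\mathsf{Prop}$ of propositional variables, the Boolean connectives, $\Box$ and $\Diamond$. $\mathsf{KTB}$ is the smallest normal modal logic containing $(T)$ $\Box\varphi\to\varphi$ and $(B)$ $\varphi\to\Box\Diamond\varphi$ (equivalently, the logic of reflexive symmetric Kripke frames). Boolean-valued models. For a complete Boolean algebra $B$ (bottom $0$, top $1$, complement $a^\ast$, $a\to b:=a^\ast\vee b$), define by transfinite recursion $V^{(B)}_\alpha=\{x: x$ is a function, $\mathrm{ran}(x)\subseteq B$, and $\mathrm{dom}(x)\subseteq V^{(B)}_\xi$ for some $\xi<\alpha\}$ and $V^{(B)}=\bigcup_\alpha V^{(B)}_\alpha$. $L_B$ is the first-order language of set theory expanded by a constant symbol for each element of $V^{(B)}$, and $\mathsf{Sent}(L_B)$ is the class of its sentences. The Boolean value $\llbracket\cdot\rrbracket_B:\mathsf{Sent}(L_B)\to B$ is defined recursively by $\llbracket u\in v\rrbracket_B=\bigvee_{x\in\mathrm{dom}(v)}(v(x)\wedge\llbracket x=u\rrbracket_B)$, $\llbracket u=v\rrbracket_B=\bigwedge_{x\in\mathrm{dom}(u)}(u(x)\to\llbracket x\in v\rrbracket_B)\wedge\bigwedge_{y\in\mathrm{dom}(v)}(v(y)\to\llbracket y\in u\rrbracket_B)$, the Boolean operations for the connectives,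 and meets (resp. joins) over $V^{(B)}$ for $\forall$ (resp. $\exists$). Translation models. $B^+:=B\setminus\{0\}$. A $B$-translation is a map $T:\mathsf{Prop}\to\mathsf{Sent}(L_B)$; it induces $v_T:\mathsf{Prop}\to B$, $v_T(p)=\llbracket T(p)\rrbracket_B$. For nonempty $W\subseteq B^+$, $M_{B,W,T}$ is the Kripke model with set of states $W$, accessibility $aRb\iff a\wedge b\neq 0$, and atomic satisfaction $M_{B,W,T},b\models p\iff b\le v_T(p)$; other connectives and modalities are interpreted by the usual Kripke clauses. $M_{B,W,T}\models\varphi$ means that $\varphi$ holds at every $b\in W$. *)

theory Defs
  imports
    "HOL-Algebra.Complete_Lattice"
    "HOL-Library.Countable"
    "HOL-Library.Multiset"
begin

section \<open>Modal formulas and the logic KTB\<close>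

text \<open>The type of propositional variables is an arbitrary countable type \<open>'p\<close>.\<close>

datatype 'p mform =
    Atom 'p
  | Fls
  | Neg "'p mform"
  | And "'p mform" "'p mform"
  | Or "'p mform" "'p mform"
  | Imp "'p mform" "'p mform"
  | Box "'p mform"
  | Dia "'p mform"

text \<open>Truth-functional evaluation: propositional variables and formulas beginning with a modality
  receive arbitrary truth values.\<close>

primrec truth :: "('p mform \<Rightarrow> bool) \<Rightarrow> 'p mform \<Rightarrow> bool" where
  "truth e (Atom p) = e (Atom p)"
| "truth e Fls = False"
| "truth e (Neg \<phi>) = (\<not> truth e \<phi>)"
| "truth e (And \<phi> \<psi>) = (truth e \<phi> \<and> truth e \<psi>)"
| "truth e (Or \<phi> \<psi>) = (truth e \<phi> \<or> truth e \<psi>)"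
| "truth e (Imp \<phi> \<psi>) = (truth e \<phi> \<longrightarrow> truth e \<psi>)"
| "truth e (Box \<phi>) = e (Box \<phi>)"
| "truth e (Dia \<phi>) = e (Dia \<phi>)"

definition tautology :: "'p mform \<Rightarrow> bool" where
  "tautology \<phi> \<longleftrightarrow> (\<forall>e. truth e \<phi>)"

primrec msubst :: "('p \<Rightarrow> 'p mform) \<Rightarrow> 'p mform \<Rightarrow> 'p mform" where
  "msubst \<sigma> (Atom p) = \<sigma> p"
| "msubst \<sigma> Fls = Fls"
| "msubst \<sigma> (Neg \<phi>) = Neg (msubst \<sigma> \<phi>)"
| "msubst \<sigma> (And \<phi> \<psi>) = And (msubst \<sigma> \<phi>) (msubst \<sigma> \<psi>)"
| "msubst \<sigma> (Or \<phi> \<psi>) = Or (msubst \<sigma> \<phi>) (msubst \<sigma> \<psi>)"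
| "msubst \<sigma> (Imp \<phi> \<psi>) = Imp (msubst \<sigma> \<phi>) (msubst \<sigma> \<psi>)"
| "msubst \<sigma> (Box \<phi>) = Box (msubst \<sigma> \<phi>)"
| "msubst \<sigma> (Dia \<phi>) = Dia (msubst \<sigma> \<phi>)"

text \<open>Both modalities are primitive, so a normal logic has to contain their duality.\<close>

definition normal_logic :: "'p mform set \<Rightarrow> bool" where
  "normal_logic L \<longleftrightarrow>
     (\<forall>\<phi>. tautology \<phi> \<longrightarrow> \<phi> \<in> L) \<and>
     (\<forall>\<phi> \<psi>. Imp (Box (Imp \<phi> \<psi>)) (Imp (Box \<phi>) (Box \<psi>)) \<in> L) \<and>
     (\<forall>\<phi>. Imp (Dia \<phi>) (Neg (Box (Neg \<phi>))) \<in> L) \<and>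
     (\<forall>\<phi>. Imp (Neg (Box (Neg \<phi>))) (Dia \<phi>) \<in> L) \<and>
     (\<forall>\<phi> \<psi>. Imp \<phi> \<psi> \<in> L \<and> \<phi> \<in> L \<longrightarrow> \<psi> \<in> L) \<and>
     (\<forall>\<sigma> \<phi>. \<phi> \<in> L \<longrightarrow> msubst \<sigma> \<phi> \<in> L) \<and>
     (\<forall>\<phi>. \<phi> \<in> L \<longrightarrow> Box \<phi> \<in> L)"

definition KTB :: "'p mform set" where
  "KTB = \<Inter>{L. normal_logic L \<and>
              (\<forall>\<phi>. Imp (Box \<phi>) \<phi> \<in> L) \<and>
              (\<forall>\<phi>. Imp \<phi> (Box (Dia \<phi>)) \<in> L)}"

section \<open>Kripke models\<close>

record ('w, 'p) kripke_model =
  states :: "'w set"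
  acc :: "'w \<Rightarrow> 'w \<Rightarrow> bool"
  val :: "'w \<Rightarrow> 'p \<Rightarrow> bool"

primrec sat :: "('w, 'p) kripke_model \<Rightarrow> 'w \<Rightarrow> 'p mform \<Rightarrow> bool" where
  "sat M a (Atom p) = val M a p"
| "sat M a Fls = False"
| "sat M a (Neg \<phi>) = (\<not> sat M a \<phi>)"
| "sat M a (And \<phi> \<psi>) = (sat M a \<phi> \<and> sat M a \<psi>)"
| "sat M a (Or \<phi> \<psi>) = (sat M a \<phi> \<or> sat M a \<psi>)"
| "sat M a (Imp \<phi> \<psi>) = (sat M a \<phi> \<longrightarrow> sat M a \<psi>)"
| "sat M a (Box \<phi>) = (\<forall>b\<in>states M. acc M a b \<longrightarrow> sat M b \<phi>)"
| "sat M a (Dia \<phi>) = (\<exists>b\<in>states M. acc M a b \<and> sat M b \<phi>)"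

definition holds_in :: "('w, 'p) kripke_model \<Rightarrow> 'p mform \<Rightarrow> bool" where
  "holds_in M \<phi> \<longleftrightarrow> (\<forall>a\<in>states M. sat M a \<phi>)"

section \<open>The set-theoretic universe\<close>

text \<open>A type of class \<open>zfc\<close> is a universe \<open>V\<close> of sets: \<open>elts x\<close> is the extension of the set \<open>x\<close>,
  and subsets of the type are the classes. Separation and Replacement range over arbitrary
  predicates and functions of HOL; Choice is then inherited from HOL. No instance can be constructed
  in HOL: the class makes the ambient set theory explicit without adding axioms.\<close>

class zfc =
  fixes elts :: "'a \<Rightarrow> 'a set"
  assumes extensionality: "elts x = elts y \<Longrightarrow> x = y"
    and foundation: "wf {(x, y). x \<in> elts y}"
    and pairing: "\<exists>z. elts z = {x, y}"
    and union: "\<exists>z. elts z = (\<Union>y\<in>elts x. elts y)"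
    and powerset: "\<exists>z. elts z = {y. elts y \<subseteq> elts x}"
    and infinity: "\<exists>z. (\<exists>e\<in>elts z. elts e = {}) \<and>
                       (\<forall>y\<in>elts z. \<exists>s\<in>elts z. elts s = insert y (elts y))"
    and separation: "\<exists>z. elts z = {y \<in> elts x. P y}"
    and replacement: "\<exists>z. elts z = F ` elts x"

definition is_set :: "'v::zfc set \<Rightarrow> bool" where
  "is_set A \<longleftrightarrow> (\<exists>z. elts z = A)"

definition vset :: "'v::zfc set \<Rightarrow> 'v" where
  "vset A = (THE z. elts z = A)"

definition vpair :: "'v::zfc \<Rightarrow> 'v \<Rightarrow> 'v" where
  "vpair x y = vset {vset {x}, vset {x, y}}"

definition vfunction :: "'v::zfc \<Rightarrow> bool" where
  "vfunction f \<longleftrightarrow> (\<forall>z\<in>elts f. \<exists>x y. z = vpair x y) \<and>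
                   (\<forall>x y y'. vpair x y \<in> elts f \<and> vpair x y' \<in> elts f \<longrightarrow> y = y')"

definition vdom :: "'v::zfc \<Rightarrow> 'v set" where
  "vdom f = {x. \<exists>y. vpair x y \<in> elts f}"

definition vran :: "'v::zfc \<Rightarrow> 'v set" where
  "vran f = {y. \<exists>x. vpair x y \<in> elts f}"

definition vapp :: "'v::zfc \<Rightarrow> 'v \<Rightarrow> 'v" where
  "vapp f x = (THE y. vpair x y \<in> elts f)"

definition vtransitive :: "'v::zfc \<Rightarrow> bool" where
  "vtransitive x \<longleftrightarrow> (\<forall>y\<in>elts x. elts y \<subseteq> elts x)"

definition vordinal :: "'v::zfc \<Rightarrow> bool" where
  "vordinal \<alpha> \<longleftrightarrow> vtransitive \<alpha> \<and> (\<forall>\<xi>\<in>elts \<alpha>. vtransitive \<xi>)"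

definition vmember :: "('v::zfc \<times> 'v) set" where
  "vmember = {(x, y). x \<in> elts y}"

lemma wf_vmember: "wf vmember"
  unfolding vmember_def by (rule foundation)

lemma elts_vset: "elts z = A \<Longrightarrow> elts (vset A) = A"
  unfolding vset_def by (rule theI2[of _ z]) (auto intro: extensionality)

lemma vdom_vmember:
  assumes "x \<in> vdom f"
  shows "(x, f) \<in> vmember\<^sup>+"
proof -
  obtain y where y: "vpair x y \<in> elts f"
    using assms by (auto simp: vdom_def)
  have pair: "elts (vset {a, b}) = {a, b}" for a b :: 'a
    using pairing[of a b] elts_vset by blast
  have "(x, vset {x}) \<in> vmember"
    using pair[of x x] by (simp add: vmember_def)
  moreover have "(vset {x}, vpair x y) \<in> vmember"
    using pair[of "vset {x}" "vset {x, y}"] by (simp add: vmember_def vpair_def)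
  moreover have "(vpair x y, f) \<in> vmember"
    using y by (simp add: vmember_def)
  ultimately show ?thesis
    by (blast intro: r_into_trancl trancl_into_trancl)
qed

lemma vdom_mult:
  assumes "a \<in> vdom b"
  shows "({#a, c#}, {#b, c#}) \<in> mult (vmember\<^sup>+)"
  using one_step_implies_mult[of "{#b#}" "{#a#}" "vmember\<^sup>+" "{#c#}"] vdom_vmember[OF assms]
  by (simp add: add_mset_commute)

section \<open>Complete Boolean algebras\<close>

text \<open>Boolean algebras are given by a carrier and an order. The one-element algebra is not excluded;
  it has no nonempty set of nonzero elements.\<close>

locale complete_boolean_alg = complete_lattice B for B (structure) +
  assumes meet_join_distrib:
      "\<lbrakk>x \<in> carrier B; y \<in> carrier B; z \<in> carrier B\<rbrakk> \<Longrightarrow> x \<sqinter> (y \<squnion> z) = (x \<sqinter> y) \<squnion> (x \<sqinter> z)"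
    and complement_exists:
      "x \<in> carrier B \<Longrightarrow> \<exists>y\<in>carrier B. x \<sqinter> y = \<bottom> \<and> x \<squnion> y = \<top>"

definition bcompl :: "'v gorder \<Rightarrow> 'v \<Rightarrow> 'v" where
  "bcompl B a = (THE c. c \<in> carrier B \<and> a \<sqinter>\<^bsub>B\<^esub> c = \<bottom>\<^bsub>B\<^esub> \<and> a \<squnion>\<^bsub>B\<^esub> c = \<top>\<^bsub>B\<^esub>)"

definition bimp :: "'v gorder \<Rightarrow> 'v \<Rightarrow> 'v \<Rightarrow> 'v" where
  "bimp B a b = bcompl B a \<squnion>\<^bsub>B\<^esub> b"

definition positive :: "'v gorder \<Rightarrow> 'v set" where
  "positive B = carrier B - {\<bottom>\<^bsub>B\<^esub>}"

lemma supr_cong [fundef_cong]: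
  "A = A' \<Longrightarrow> (\<And>x. x \<in> A' \<Longrightarrow> f x = g x) \<Longrightarrow> supr L A f = supr L A' g"
  unfolding supr_def by (metis image_cong)

lemma infi_cong [fundef_cong]:
  "A = A' \<Longrightarrow> (\<And>x. x \<in> A' \<Longrightarrow> f x = g x) \<Longrightarrow> infi L A f = infi L A' g"
  unfolding infi_def by (metis image_cong)

section \<open>The Boolean-valued universe\<close>

function stage :: "'v::zfc gorder \<Rightarrow> 'v \<Rightarrow> 'v set" where
  "stage B \<alpha> = {x. vfunction x \<and> vran x \<subseteq> carrier B \<and> (\<exists>\<xi>\<in>elts \<alpha>. vdom x \<subseteq> stage B \<xi>)}"
  by auto
termination
  by (relation "inv_image vmember snd") (auto simp: wf_vmember, auto simp: vmember_def)

declare stage.simps [simp del]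

definition names :: "'v::zfc gorder \<Rightarrow> 'v set" where
  "names B = (\<Union>\<alpha>\<in>{\<alpha>. vordinal \<alpha>}. stage B \<alpha>)"

text \<open>\<open>val_mem B u v\<close> is the value of \<open>u \<in> v\<close> and \<open>val_eq B u v\<close> that of \<open>u = v\<close>. The recursion makes
  sense for arbitrary \<open>u\<close>, \<open>v\<close>; only its values on names are of interest.\<close>

function val_mem :: "'v::zfc gorder \<Rightarrow> 'v \<Rightarrow> 'v \<Rightarrow> 'v"
  and val_eq :: "'v::zfc gorder \<Rightarrow> 'v \<Rightarrow> 'v \<Rightarrow> 'v"
where
  "val_mem B u v = (SSUP\<^bsub>B\<^esub> x:vdom v. vapp v x \<sqinter>\<^bsub>B\<^esub> val_eq B x u)"
| "val_eq B u v =
     (IINF\<^bsub>B\<^esub> x:vdom u. bimp B (vapp u x) (val_mem B x v)) \<sqinter>\<^bsub>B\<^esub>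
     (IINF\<^bsub>B\<^esub> y:vdom v. bimp B (vapp v y) (val_mem B y u))"
  by pat_completeness auto
termination
proof (relation "inv_image (mult (vmember\<^sup>+))
    (\<lambda>c. case c of Inl (B, u, v) \<Rightarrow> {#u, v#} | Inr (B, u, v) \<Rightarrow> {#u, v#})", goal_cases)
  case 1
  show ?case
    by (intro wf_inv_image wf_mult wf_trancl wf_vmember)
next
  case (2 B u v x)
  then show ?case
    using vdom_mult[of x v u] by (simp add: add_mset_commute)
next
  case (3 B u v x)
  then show ?case
    using vdom_mult[of x u v] by simp
next
  case (4 B u v y)
  then show ?case
    using vdom_mult[of y v u] by (simp add: add_mset_commute)
qed

declare val_mem.simps [simp del] val_eq.simps [simp del]

section \<open>The language of set theory with constants\<close>

datatype 'v sterm = SVar nat | SConst (the_const: 'v)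

datatype 'v sform =
    SMem "'v sterm" "'v sterm"
  | SEq "'v sterm" "'v sterm"
  | SNeg "'v sform"
  | SAnd "'v sform" "'v sform"
  | SOr "'v sform" "'v sform"
  | SImp "'v sform" "'v sform"
  | SAll nat "'v sform"
  | SEx nat "'v sform"

primrec free_vars_term :: "'v sterm \<Rightarrow> nat set" where
  "free_vars_term (SVar i) = {i}"
| "free_vars_term (SConst u) = {}"

primrec free_vars :: "'v sform \<Rightarrow> nat set" where
  "free_vars (SMem s t) = free_vars_term s \<union> free_vars_term t"
| "free_vars (SEq s t) = free_vars_term s \<union> free_vars_term t"
| "free_vars (SNeg \<phi>) = free_vars \<phi>"
| "free_vars (SAnd \<phi> \<psi>) = free_vars \<phi> \<union> free_vars \<psi>"
| "free_vars (SOr \<phi> \<psi>) = free_vars \<phi> \<union> free_vars \<psi>"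
| "free_vars (SImp \<phi> \<psi>) = free_vars \<phi> \<union> free_vars \<psi>"
| "free_vars (SAll i \<phi>) = free_vars \<phi> - {i}"
| "free_vars (SEx i \<phi>) = free_vars \<phi> - {i}"

text \<open>\<open>set_sform \<phi>\<close> is the set of constants occurring in \<open>\<phi>\<close>.\<close>

definition Sent :: "'v::zfc gorder \<Rightarrow> 'v sform set" where
  "Sent B = {\<phi>. free_vars \<phi> = {} \<and> set_sform \<phi> \<subseteq> names B}"

primrec inst_term :: "nat \<Rightarrow> 'v \<Rightarrow> 'v sterm \<Rightarrow> 'v sterm" where
  "inst_term i u (SVar j) = (if j = i then SConst u else SVar j)"
| "inst_term i u (SConst w) = SConst w"

text \<open>\<open>inst i u \<phi>\<close> replaces the free occurrences of the variable \<open>i\<close> in \<open>\<phi>\<close> by the constant \<open>u\<close>.\<close>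

primrec inst :: "nat \<Rightarrow> 'v \<Rightarrow> 'v sform \<Rightarrow> 'v sform" where
  "inst i u (SMem s t) = SMem (inst_term i u s) (inst_term i u t)"
| "inst i u (SEq s t) = SEq (inst_term i u s) (inst_term i u t)"
| "inst i u (SNeg \<phi>) = SNeg (inst i u \<phi>)"
| "inst i u (SAnd \<phi> \<psi>) = SAnd (inst i u \<phi>) (inst i u \<psi>)"
| "inst i u (SOr \<phi> \<psi>) = SOr (inst i u \<phi>) (inst i u \<psi>)"
| "inst i u (SImp \<phi> \<psi>) = SImp (inst i u \<phi>) (inst i u \<psi>)"
| "inst i u (SAll j \<phi>) = SAll j (if j = i then \<phi> else inst i u \<phi>)"
| "inst i u (SEx j \<phi>) = SEx j (if j = i then \<phi> else inst i u \<phi>)"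

primrec height :: "'v sform \<Rightarrow> nat" where
  "height (SMem s t) = 0"
| "height (SEq s t) = 0"
| "height (SNeg \<phi>) = Suc (height \<phi>)"
| "height (SAnd \<phi> \<psi>) = Suc (height \<phi> + height \<psi>)"
| "height (SOr \<phi> \<psi>) = Suc (height \<phi> + height \<psi>)"
| "height (SImp \<phi> \<psi>) = Suc (height \<phi> + height \<psi>)"
| "height (SAll i \<phi>) = Suc (height \<phi>)"
| "height (SEx i \<phi>) = Suc (height \<phi>)"

lemma height_inst [simp]: "height (inst i u \<phi>) = height \<phi>"
  by (induction \<phi>) auto

text \<open>In a sentence every atomic subformula reached by the recursion compares two constants, so the
  unspecified value of \<open>the_const\<close> on variables plays no role.\<close>

function bval :: "'v::zfc gorder \<Rightarrow> 'v sform \<Rightarrow> 'v" where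
  "bval B (SMem s t) = val_mem B (the_const s) (the_const t)"
| "bval B (SEq s t) = val_eq B (the_const s) (the_const t)"
| "bval B (SNeg \<phi>) = bcompl B (bval B \<phi>)"
| "bval B (SAnd \<phi> \<psi>) = bval B \<phi> \<sqinter>\<^bsub>B\<^esub> bval B \<psi>"
| "bval B (SOr \<phi> \<psi>) = bval B \<phi> \<squnion>\<^bsub>B\<^esub> bval B \<psi>"
| "bval B (SImp \<phi> \<psi>) = bimp B (bval B \<phi>) (bval B \<psi>)"
| "bval B (SAll i \<phi>) = (IINF\<^bsub>B\<^esub> u:names B. bval B (inst i u \<phi>))"
| "bval B (SEx i \<phi>) = (SSUP\<^bsub>B\<^esub> u:names B. bval B (inst i u \<phi>))"
  by pat_completeness auto
termination
  by (relation "measure (\<lambda>(B, \<phi>). height \<phi>)") auto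

section \<open>Translation models\<close>

definition translation :: "'v::zfc gorder \<Rightarrow> ('p \<Rightarrow> 'v sform) \<Rightarrow> bool" where
  "translation B T \<longleftrightarrow> (\<forall>p. T p \<in> Sent B)"

definition translation_model ::
  "'v::zfc gorder \<Rightarrow> 'v set \<Rightarrow> ('p \<Rightarrow> 'v sform) \<Rightarrow> ('v, 'p) kripke_model" where
  "translation_model B W T =
     \<lparr>states = W,
      acc = (\<lambda>a b. a \<sqinter>\<^bsub>B\<^esub> b \<noteq> \<bottom>\<^bsub>B\<^esub>),
      val = (\<lambda>b p. b \<sqsubseteq>\<^bsub>B\<^esub> bval B (T p))\<rparr>"

end

theory Submission
  imports Defs
begin

text \<open>For soundness, overlap of nonzero elements is a reflexive symmetric relation. For completeness,
  a formula outside KTB fails in the canonical model, whose states form a set because the language is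
  countable. Any reflexive symmetric graph is isomorphic to the overlap graph of the sets of edges
  incident to its vertices, which lie in a power set algebra; and an arbitrary element \<open>b\<close> of a complete
  Boolean algebra is the value of the sentence \<open>\<emptyset> \<in> {(\<emptyset>, b)}\<close>.\<close>

section \<open>Soundness\<close>

text \<open>Substitution is absorbed into the valuation: a variable \<open>p\<close> is reread as
  the truth of \<open>\<sigma> p\<close>.\<close>

lemma sat_msubst:
  "sat M a (msubst \<sigma> \<phi>) = sat (M\<lparr>val := \<lambda>b p. sat M b (\<sigma> p)\<rparr>) a \<phi>"
  by (induction \<phi> arbitrary: a) auto

lemma sat_tautology: "tautology \<phi> \<Longrightarrow> sat M a \<phi>"
proof -
  have "truth (sat M a) \<phi> = sat M a \<phi>"
    by (induction \<phi>) auto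
  then show "tautology \<phi> \<Longrightarrow> sat M a \<phi>"
    by (auto simp: tautology_def)
qed

lemma KTB_sound:
  assumes "\<phi> \<in> KTB"
    and refl: "\<And>a. a \<in> states M \<Longrightarrow> acc M a a"
    and sym: "\<And>a b. a \<in> states M \<Longrightarrow> b \<in> states M \<Longrightarrow> acc M a b \<Longrightarrow> acc M b a"
  shows "holds_in M \<phi>"
proof -
  \<comment> \<open>All valuations on the frame of \<open>M\<close> are taken, since truth under a
    single one need not be closed under substitution.\<close>
  define L where "L = {\<psi>. \<forall>v. holds_in (M\<lparr>val := v\<rparr>) \<psi>}"
  have "normal_logic L"
    unfolding normal_logic_def
  proof (intro conjI allI impI)
    show "\<psi> \<in> L" if "tautology \<psi>" for \<psi>
      using that by (simp add: L_def holds_in_def sat_tautology)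
    show "msubst \<sigma> \<psi> \<in> L" if "\<psi> \<in> L" for \<sigma> \<psi>
      using that by (simp add: L_def holds_in_def sat_msubst)
  qed (auto simp: L_def holds_in_def)
  moreover have "Imp (Box \<psi>) \<psi> \<in> L" "Imp \<psi> (Box (Dia \<psi>)) \<in> L" for \<psi>
    using refl sym by (auto simp: L_def holds_in_def)
  ultimately have "KTB \<subseteq> L"
    unfolding KTB_def by (intro Inter_lower) blast
  with assms(1) have "holds_in (M\<lparr>val := val M\<rparr>) \<phi>"
    unfolding L_def by blast
  then show ?thesis by simp
qed

section \<open>The canonical model\<close>

lemma normal_logicD:
  assumes "normal_logic L"
  shows "tautology \<phi> \<Longrightarrow> \<phi> \<in> L"
    and "Imp (Box (Imp \<phi> \<psi>)) (Imp (Box \<phi>) (Box \<psi>)) \<in> L"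
    and "Imp (Dia \<phi>) (Neg (Box (Neg \<phi>))) \<in> L"
    and "Imp (Neg (Box (Neg \<phi>))) (Dia \<phi>) \<in> L"
    and "Imp \<phi> \<psi> \<in> L \<Longrightarrow> \<phi> \<in> L \<Longrightarrow> \<psi> \<in> L"
    and "\<phi> \<in> L \<Longrightarrow> Box \<phi> \<in> L"
  using assms unfolding normal_logic_def by metis+

text \<open>\<open>KTB\<close> is an intersection, so membership is tested in each logic of the
  family; the premise \<open>KTB \<subseteq> L\<close> lets the closure rules start from theorems of
  \<open>KTB\<close>.\<close>

lemma KTB_I:
  fixes \<phi> :: "'a mform"
  assumes "\<And>L. \<lbrakk>normal_logic L; \<And>\<psi>. Imp (Box \<psi>) \<psi> \<in> L;
      \<And>\<psi>. Imp \<psi> (Box (Dia \<psi>)) \<in> L;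
      KTB \<subseteq> L\<rbrakk> \<Longrightarrow> \<phi> \<in> L"
  shows "\<phi> \<in> KTB"
  unfolding KTB_def
proof (rule InterI, clarify)
  fix L :: "'a mform set"
  assume L: "normal_logic L" "\<forall>\<psi>. Imp (Box \<psi>) \<psi> \<in> L" "\<forall>\<psi>. Imp \<psi> (Box (Dia \<psi>)) \<in> L"
  then have "KTB \<subseteq> L"
    unfolding KTB_def by (intro Inter_lower) blast
  with L show "\<phi> \<in> L" by (intro assms) simp_all
qed

lemma KTB_taut: "tautology \<phi> \<Longrightarrow> \<phi> \<in> KTB"
  by (rule KTB_I) (rule normal_logicD(1))

lemma KTB_K: "Imp (Box (Imp \<phi> \<psi>)) (Imp (Box \<phi>) (Box \<psi>)) \<in> KTB"
  by (rule KTB_I) (rule normal_logicD(2))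

lemma KTB_dual: "Imp (Dia \<phi>) (Neg (Box (Neg \<phi>))) \<in> KTB" "Imp (Neg (Box (Neg \<phi>))) (Dia \<phi>) \<in> KTB"
  by (rule KTB_I, erule normal_logicD)+

lemma KTB_mp: "Imp \<phi> \<psi> \<in> KTB \<Longrightarrow> \<phi> \<in> KTB \<Longrightarrow> \<psi> \<in> KTB"
  by (rule KTB_I) (meson normal_logicD(5) subsetD)

lemma KTB_nec: "\<phi> \<in> KTB \<Longrightarrow> Box \<phi> \<in> KTB"
  by (rule KTB_I) (meson normal_logicD(6) subsetD)

lemma KTB_T: "Imp (Box \<phi>) \<phi> \<in> KTB"
  by (rule KTB_I)

lemma KTB_B: "Imp \<phi> (Box (Dia \<phi>)) \<in> KTB"
  by (rule KTB_I)

section \<open>Deducibility from hypotheses\<close>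

inductive ded :: "'p mform set \<Rightarrow> 'p mform \<Rightarrow> bool" for \<Gamma> where
  ax: "\<phi> \<in> KTB \<Longrightarrow> ded \<Gamma> \<phi>"
| hyp: "\<phi> \<in> \<Gamma> \<Longrightarrow> ded \<Gamma> \<phi>"
| mp: "ded \<Gamma> (Imp \<phi> \<psi>) \<Longrightarrow> ded \<Gamma> \<phi> \<Longrightarrow> ded \<Gamma> \<psi>"

lemma ded_mono: "ded \<Gamma> \<phi> \<Longrightarrow> \<Gamma> \<subseteq> \<Delta> \<Longrightarrow> ded \<Delta> \<phi>"
  by (induction rule: ded.induct) (auto intro: ded.intros)

lemma ded_taut: "tautology \<phi> \<Longrightarrow> ded \<Gamma> \<phi>"
  by (intro ded.ax KTB_taut)

lemma ded_conseq1: "tautology (Imp \<phi> \<psi>) \<Longrightarrow> ded \<Gamma> \<phi> \<Longrightarrow> ded \<Gamma> \<psi>"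
  by (meson ded_taut ded.mp)

lemma ded_conseq2: "tautology (Imp \<phi> (Imp \<psi> \<chi>)) \<Longrightarrow> ded \<Gamma> \<phi> \<Longrightarrow> ded \<Gamma> \<psi> \<Longrightarrow> ded \<Gamma> \<chi>"
  by (meson ded_taut ded.mp)

lemma ded_empty: "ded {} \<phi> \<Longrightarrow> \<phi> \<in> KTB"
  by (induction rule: ded.induct) (auto intro: KTB_mp)

text \<open>The deduction theorem holds without restriction because modus ponens is the only rule of
  \<open>ded\<close>; necessitation is confined to theorems, inside \<open>ax\<close>.\<close>

lemma ded_insert: "ded (insert \<phi> \<Gamma>) \<psi> \<Longrightarrow> ded \<Gamma> (Imp \<phi> \<psi>)"
proof (induction rule: ded.induct)
  case (ax \<psi>)
  then show ?case by (auto intro: ded_conseq1[OF _ ded.ax] simp: tautology_def)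
next
  case (hyp \<psi>)
  then show ?case
    by (auto intro: ded_taut ded_conseq1[OF _ ded.hyp] simp: tautology_def)
next
  case (mp \<chi> \<psi>)
  show ?case
    by (rule ded_conseq2[OF _ mp.IH]) (auto simp: tautology_def)
qed

text \<open>A deduction can be boxed step by step: theorems by necessitation, modus ponens by axiom
  K.\<close>

lemma ded_Box: "ded \<Gamma> \<phi> \<Longrightarrow> ded (Box ` \<Gamma>) (Box \<phi>)"
proof (induction rule: ded.induct)
  case (mp \<phi> \<psi>)
  then show ?case by (meson ded.intros KTB_K)
qed (auto intro: ded.intros KTB_nec)

text \<open>Compactness along a chain: at each modus ponens the larger of two comparable members
  serves both premises. Nonemptiness supplies a member in the case \<open>ax\<close>.\<close>

lemma ded_Union_chain:
  assumes "ded (\<Union>C) \<phi>" and chain: "subset.chain A C" and "C \<noteq> {}"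
  shows "\<exists>\<Gamma>\<in>C. ded \<Gamma> \<phi>"
  using assms(1)
proof (induction rule: ded.induct)
  case (mp \<phi> \<psi>)
  then obtain \<Gamma> \<Delta> where *: "\<Gamma> \<in> C" "\<Delta> \<in> C" "ded \<Gamma> (Imp \<phi> \<psi>)" "ded \<Delta> \<phi>" by blast
  with chain have "\<Gamma> \<subseteq> \<Delta> \<or> \<Delta> \<subseteq> \<Gamma>" by (auto simp: subset.chain_def)
  with * show ?case by (meson ded.mp ded_mono)
qed (use \<open>C \<noteq> {}\<close> in \<open>auto intro: ded.intros\<close>)

section \<open>Maximal consistent sets\<close>

definition mcs :: "'p mform set \<Rightarrow> bool" where
  "mcs \<Gamma> \<longleftrightarrow> \<not> ded \<Gamma> Fls \<and> (\<forall>\<phi>. \<phi> \<in> \<Gamma> \<or> Neg \<phi> \<in> \<Gamma>)"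

text \<open>Zorn's lemma is applied to the extensions that do not derive \<open>\<phi>\<close>. In a
  maximal one every absent formula implies \<open>\<phi>\<close>, so if \<open>\<psi>\<close> and
  \<open>Neg \<psi>\<close> were both absent, a case distinction would derive
  \<open>\<phi>\<close>.\<close>

lemma lindenbaum:
  assumes "\<not> ded \<Gamma> \<phi>"
  obtains \<Delta> where "\<Gamma> \<subseteq> \<Delta>" "mcs \<Delta>" "\<not> ded \<Delta> \<phi>"
proof -
  let ?A = "{\<Delta>. \<Gamma> \<subseteq> \<Delta> \<and> \<not> ded \<Delta> \<phi>}"
  have "\<exists>\<Delta>\<in>?A. \<forall>X\<in>?A. \<Delta> \<subseteq> X \<longrightarrow> X = \<Delta>"
  proof (rule subset_Zorn_nonempty)
    fix C assume C: "C \<noteq> {}" "subset.chain ?A C"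
    then have "C \<subseteq> ?A" by (simp add: subset.chain_def)
    with C show "\<Union>C \<in> ?A"
      using ded_Union_chain[OF _ C(2,1)] by blast
  qed (use assms in blast)
  then obtain \<Delta> where "\<Delta> \<in> ?A" and *: "\<forall>X\<in>?A. \<Delta> \<subseteq> X \<longrightarrow> X = \<Delta>" ..
  then have \<Delta>: "\<Gamma> \<subseteq> \<Delta>" "\<not> ded \<Delta> \<phi>" by simp_all
  have max: "X = \<Delta>" if "\<Delta> \<subseteq> X" "\<not> ded X \<phi>" for X
    using *[rule_format, of X] \<Delta>(1) that by simp
  have imp: "ded \<Delta> (Imp \<psi> \<phi>)" if "\<psi> \<notin> \<Delta>" for \<psi>
    using max[of "insert \<psi> \<Delta>"] that by (intro ded_insert) blast
  have "\<psi> \<in> \<Delta> \<or> Neg \<psi> \<in> \<Delta>" for \<psi>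
  proof (rule ccontr)
    assume "\<not> ?thesis"
    then have "ded \<Delta> (Imp \<psi> \<phi>)" "ded \<Delta> (Imp (Neg \<psi>) \<phi>)" by (auto intro: imp)
    then have "ded \<Delta> \<phi>"
      by (rule ded_conseq2[rotated]) (auto simp: tautology_def)
    with \<Delta> show False by simp
  qed
  moreover have "\<not> ded \<Delta> Fls"
    using \<Delta>(2) ded_conseq1[of Fls \<phi>] by (auto simp: tautology_def)
  ultimately show ?thesis
    using \<Delta> that by (auto simp: mcs_def)
qed

lemma mcs_Neg:
  assumes "mcs \<Gamma>"
  shows "Neg \<phi> \<in> \<Gamma> \<longleftrightarrow> \<phi> \<notin> \<Gamma>"
proof -
  have "ded \<Gamma> Fls" if "\<phi> \<in> \<Gamma>" "Neg \<phi> \<in> \<Gamma>"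
    by (rule ded_conseq2[OF _ ded.hyp[OF that(1)] ded.hyp[OF that(2)]]) (simp add: tautology_def)
  with assms show ?thesis by (auto simp: mcs_def)
qed

lemma mcs_ded:
  assumes "mcs \<Gamma>" "ded \<Gamma> \<phi>"
  shows "\<phi> \<in> \<Gamma>"
proof (rule ccontr)
  assume "\<phi> \<notin> \<Gamma>"
  then have "ded \<Gamma> (Neg \<phi>)" using mcs_Neg[OF assms(1)] by (auto intro: ded.hyp)
  with assms(2) have "ded \<Gamma> Fls"
    by (rule ded_conseq2[rotated]) (simp add: tautology_def)
  with assms(1) show False by (simp add: mcs_def)
qed

lemma mcs_mp: "mcs \<Gamma> \<Longrightarrow> Imp \<phi> \<psi> \<in> \<Gamma> \<Longrightarrow> \<phi> \<in> \<Gamma> \<Longrightarrow> \<psi> \<in> \<Gamma>"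
  by (meson ded.hyp ded.mp mcs_ded)

lemma mcs_KTB: "mcs \<Gamma> \<Longrightarrow> \<phi> \<in> KTB \<Longrightarrow> \<phi> \<in> \<Gamma>"
  by (meson ded.ax mcs_ded)

lemma mcs_KTB_mp: "mcs \<Gamma> \<Longrightarrow> Imp \<phi> \<psi> \<in> KTB \<Longrightarrow> \<phi> \<in> \<Gamma> \<Longrightarrow> \<psi> \<in> \<Gamma>"
  by (meson mcs_KTB mcs_mp)

lemma mcs_Imp:
  assumes "mcs \<Gamma>"
  shows "Imp \<phi> \<psi> \<in> \<Gamma> \<longleftrightarrow> (\<phi> \<in> \<Gamma> \<longrightarrow> \<psi> \<in> \<Gamma>)"
proof -
  have "Imp \<phi> \<psi> \<in> \<Gamma>" if "\<psi> \<in> \<Gamma>"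
    using that by (rule mcs_KTB_mp[OF assms KTB_taut, rotated]) (simp add: tautology_def)
  moreover have "Imp \<phi> \<psi> \<in> \<Gamma>" if "Neg \<phi> \<in> \<Gamma>"
    using that by (rule mcs_KTB_mp[OF assms KTB_taut, rotated]) (simp add: tautology_def)
  ultimately show ?thesis
    using mcs_mp[OF assms] mcs_Neg[OF assms] by blast
qed

lemma mcs_KTB_iff:
  assumes "mcs \<Gamma>" "Imp \<phi> \<psi> \<in> KTB" "Imp \<psi> \<phi> \<in> KTB"
  shows "\<phi> \<in> \<Gamma> \<longleftrightarrow> \<psi> \<in> \<Gamma>"
  using assms mcs_KTB_mp by blast

text \<open>A tautological equivalence reduces conjunction to \<open>Neg\<close> and
  \<open>Imp\<close>; \<open>mcs_Or\<close> proceeds likewise.\<close>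

lemma mcs_And:
  assumes "mcs \<Gamma>"
  shows "And \<phi> \<psi> \<in> \<Gamma> \<longleftrightarrow> \<phi> \<in> \<Gamma> \<and> \<psi> \<in> \<Gamma>"
proof -
  have "And \<phi> \<psi> \<in> \<Gamma> \<longleftrightarrow> Neg (Imp \<phi> (Neg \<psi>)) \<in> \<Gamma>"
    by (intro mcs_KTB_iff[OF assms] KTB_taut) (auto simp: tautology_def)
  then show ?thesis
    by (simp add: mcs_Neg[OF assms] mcs_Imp[OF assms])
qed

lemma mcs_Or:
  assumes "mcs \<Gamma>"
  shows "Or \<phi> \<psi> \<in> \<Gamma> \<longleftrightarrow> \<phi> \<in> \<Gamma> \<or> \<psi> \<in> \<Gamma>"
proof -
  have "Or \<phi> \<psi> \<in> \<Gamma> \<longleftrightarrow> Imp (Neg \<phi>) \<psi> \<in> \<Gamma>"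
    by (intro mcs_KTB_iff[OF assms] KTB_taut) (auto simp: tautology_def)
  then show ?thesis
    by (auto simp: mcs_Neg[OF assms] mcs_Imp[OF assms])
qed

section \<open>The canonical model and its truth lemma\<close>

definition canonical :: "('p mform set, 'p) kripke_model" where
  "canonical = \<lparr>states = {\<Gamma>. mcs \<Gamma>},
                acc = (\<lambda>\<Gamma> \<Delta>. \<forall>\<phi>. Box \<phi> \<in> \<Gamma> \<longrightarrow> \<phi> \<in> \<Delta>),
                val = (\<lambda>\<Gamma> p. Atom p \<in> \<Gamma>)\<rparr>"

lemma mcs_Dia: "mcs \<Gamma> \<Longrightarrow> Dia \<phi> \<in> \<Gamma> \<longleftrightarrow> Box (Neg \<phi>) \<notin> \<Gamma>"
  using mcs_KTB_iff[OF _ KTB_dual] mcs_Neg by blast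

text \<open>The existence lemma. If the formulas boxed in \<open>\<Gamma>\<close> do not derive
  \<open>\<phi>\<close>, \<open>lindenbaum\<close> yields a successor without \<open>\<phi>\<close>;
  if they do, boxing the deduction puts \<open>Box \<phi>\<close> into
  \<open>\<Gamma>\<close>.\<close>

lemma mcs_Box:
  assumes "mcs \<Gamma>"
  shows "Box \<phi> \<in> \<Gamma> \<longleftrightarrow> (\<forall>\<Delta>. mcs \<Delta> \<and> {\<psi>. Box \<psi> \<in> \<Gamma>} \<subseteq> \<Delta> \<longrightarrow> \<phi> \<in> \<Delta>)"
proof
  assume *: "\<forall>\<Delta>. mcs \<Delta> \<and> {\<psi>. Box \<psi> \<in> \<Gamma>} \<subseteq> \<Delta> \<longrightarrow> \<phi> \<in> \<Delta>"
  have "ded {\<psi>. Box \<psi> \<in> \<Gamma>} \<phi>"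
  proof (rule ccontr)
    assume "\<not> ?thesis"
    then obtain \<Delta> where "{\<psi>. Box \<psi> \<in> \<Gamma>} \<subseteq> \<Delta>" "mcs \<Delta>" "\<not> ded \<Delta> \<phi>" by (rule lindenbaum)
    with * show False by (auto intro: ded.hyp)
  qed
  from ded_Box[OF this] have "ded \<Gamma> (Box \<phi>)" by (rule ded_mono) auto
  with assms show "Box \<phi> \<in> \<Gamma>" by (rule mcs_ded)
qed blast

lemma canonical_truth: "mcs \<Gamma> \<Longrightarrow> sat canonical \<Gamma> \<phi> \<longleftrightarrow> \<phi> \<in> \<Gamma>"
proof (induction \<phi> arbitrary: \<Gamma>)
  case Fls
  then show ?case by (auto simp: mcs_def intro: ded.hyp)
next
  case (Box \<phi>)
  then have "sat canonical \<Gamma> (Box \<phi>) \<longleftrightarrow> (\<forall>\<Delta>. mcs \<Delta> \<and> {\<psi>. Box \<psi> \<in> \<Gamma>} \<subseteq> \<Delta> \<longrightarrow> \<phi> \<in> \<Delta>)"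
    by (auto simp: canonical_def)
  also have "\<dots> \<longleftrightarrow> Box \<phi> \<in> \<Gamma>"
    using Box.prems by (rule mcs_Box[symmetric])
  finally show ?case .
next
  case (Dia \<phi>)
  then have "sat canonical \<Gamma> (Dia \<phi>) \<longleftrightarrow> (\<exists>\<Delta>. mcs \<Delta> \<and> {\<psi>. Box \<psi> \<in> \<Gamma>} \<subseteq> \<Delta> \<and> \<phi> \<in> \<Delta>)"
    by (auto simp: canonical_def)
  \<comment> \<open>Passing to \<open>Box (Neg \<phi>)\<close> is no circularity:
    \<open>mcs_Box\<close> speaks of membership only, so the induction hypothesis for
    \<open>\<phi>\<close> suffices.\<close>
  also have "\<dots> \<longleftrightarrow> \<not> (\<forall>\<Delta>. mcs \<Delta> \<and> {\<psi>. Box \<psi> \<in> \<Gamma>} \<subseteq> \<Delta> \<longrightarrow> Neg \<phi> \<in> \<Delta>)"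
    by (metis mcs_Neg)
  also have "\<dots> \<longleftrightarrow> Box (Neg \<phi>) \<notin> \<Gamma>"
    by (simp only: mcs_Box[OF Dia.prems, of "Neg \<phi>"])
  also have "\<dots> \<longleftrightarrow> Dia \<phi> \<in> \<Gamma>"
    using mcs_Dia[OF Dia.prems] by simp
  finally show ?case .
qed (auto simp: mcs_Neg mcs_And mcs_Or mcs_Imp, auto simp: canonical_def)

lemma canonical_refl: "\<Gamma> \<in> states canonical \<Longrightarrow> acc canonical \<Gamma> \<Gamma>"
  by (auto simp: canonical_def intro: mcs_KTB_mp[OF _ KTB_T])

text \<open>Axiom B at work: if \<open>\<phi>\<close> is missing from \<open>\<Gamma>\<close>, then
  \<open>Box (Dia (Neg \<phi>))\<close> lies in \<open>\<Gamma>\<close> and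
  \<open>Dia (Neg \<phi>)\<close> in \<open>\<Delta>\<close>, which contradicts
  \<open>Box \<phi>\<close> in \<open>\<Delta>\<close>.\<close>

lemma canonical_sym:
  assumes "\<Gamma> \<in> states canonical" "\<Delta> \<in> states canonical" "acc canonical \<Gamma> \<Delta>"
  shows "acc canonical \<Delta> \<Gamma>"
proof -
  from assms have mcs: "mcs \<Gamma>" "mcs \<Delta>" and acc: "\<And>\<phi>. Box \<phi> \<in> \<Gamma> \<Longrightarrow> \<phi> \<in> \<Delta>"
    by (auto simp: canonical_def)
  have "\<phi> \<in> \<Gamma>" if "Box \<phi> \<in> \<Delta>" for \<phi>
  proof (rule ccontr)
    assume "\<phi> \<notin> \<Gamma>"
    with mcs have "Neg \<phi> \<in> \<Gamma>" by (simp add: mcs_Neg)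
    then have "Dia (Neg \<phi>) \<in> \<Delta>"
      by (intro acc mcs_KTB_mp[OF mcs(1) KTB_B])
    then have "Box (Neg (Neg \<phi>)) \<notin> \<Delta>" using mcs mcs_Dia by blast
    \<comment> \<open>Duality produced a double negation under the box; necessitation and K bring
      \<open>Box \<phi>\<close> to that form.\<close>
    moreover have "Imp (Box \<phi>) (Box (Neg (Neg \<phi>))) \<in> KTB"
      by (intro KTB_mp[OF KTB_K] KTB_nec KTB_taut) (simp add: tautology_def)
    ultimately show False using that mcs mcs_KTB_mp by blast
  qed
  then show ?thesis by (simp add: canonical_def)
qed

lemma canonical_complete:
  assumes "\<phi> \<notin> KTB"
  obtains \<Gamma> where "\<Gamma> \<in> states canonical" "\<not> sat canonical \<Gamma> \<phi>"
proof -
  have "\<not> ded {} \<phi>" using assms ded_empty by blast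
  then obtain \<Gamma> where "mcs \<Gamma>" "\<not> ded \<Gamma> \<phi>" by (rule lindenbaum)
  then show ?thesis
    using that[of \<Gamma>] canonical_truth[of \<Gamma> \<phi>] by (auto simp: canonical_def intro: ded.hyp)
qed

section \<open>Sets in the universe\<close>

lemma elts_vset_is_set: "is_set A \<Longrightarrow> elts (vset A) = A"
  by (auto simp: is_set_def elts_vset)

lemma is_set_elts [simp]: "is_set (elts x)"
  by (auto simp: is_set_def)

lemma is_set_subset: "is_set B \<Longrightarrow> A \<subseteq> B \<Longrightarrow> is_set A"
  unfolding is_set_def using separation[of _ "\<lambda>x. x \<in> A"] by (metis Collect_mem_eq Int_absorb1 Int_def)

lemma is_set_Pow: "is_set A \<Longrightarrow> is_set {y. elts y \<subseteq> A}"
  unfolding is_set_def using powerset by blast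

lemma is_set_pair [simp]: "is_set {x, y}"
  unfolding is_set_def by (rule pairing)

lemma is_set_singleton [simp]: "is_set {x}"
  using is_set_pair[of x x] by simp

lemma is_set_empty [simp]: "is_set {}"
  using is_set_subset[OF is_set_singleton] by blast

text \<open>The result is the union of the pair of \<open>{x}\<close> and \<open>A\<close>.\<close>

lemma is_set_insert:
  assumes "is_set A"
  shows "is_set (insert x A)"
proof -
  obtain z where "elts z = (\<Union>y\<in>elts (vset {vset {x}, vset A}). elts y)"
    using union by blast
  then have "elts z = insert x A"
    using assms by (simp add: elts_vset_is_set)
  then show ?thesis unfolding is_set_def by blast
qed

lemma vset_inject: "is_set A \<Longrightarrow> is_set B \<Longrightarrow> vset A = vset B \<longleftrightarrow> A = B"
  by (metis elts_vset_is_set)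

lemma vpair_inject [simp]: "vpair x y = vpair x' y' \<longleftrightarrow> x = x' \<and> y = y'"
  unfolding vpair_def by (auto simp: vset_inject doubleton_eq_iff)

text \<open>The von Neumann numerals. Each is an element of every later one, and by foundation no
  set is an element of itself, so they are distinct.\<close>

lemma omega_inj:
  obtains f :: "nat \<Rightarrow> 'v::zfc" where "inj f" "is_set (range f)"
proof -
  obtain z :: 'v where z: "\<exists>e\<in>elts z. elts e = {}"
      "\<forall>y\<in>elts z. \<exists>s\<in>elts z. elts s = insert y (elts y)"
    using infinity by (elim exE conjE) (rule that)
  from z(1) obtain e where e: "e \<in> elts z" ..
  define f where "f = rec_nat e (\<lambda>_ y. vset (insert y (elts y)))"
  have f_Suc: "elts (f (Suc n)) = insert (f n) (elts (f n))" for n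
    unfolding f_def by (simp add: elts_vset_is_set is_set_insert)
  have "f n \<in> elts z" for n
  proof (induction n)
    case 0
    then show ?case by (simp add: f_def e)
  next
    case (Suc n)
    with z(2) obtain s where "s \<in> elts z" "elts s = elts (f (Suc n))"
      by (auto simp: f_Suc)
    \<comment> \<open>Infinity only provides some set with the right elements; extensionality
      identifies it with the next numeral.\<close>
    then show ?case using extensionality by metis
  qed
  then have "is_set (range f)"
    by (intro is_set_subset[OF is_set_elts[of z]]) auto
  moreover have mem: "f m \<in> elts (f n)" if "m < n" for m n
    using that by (induction n) (auto simp: f_Suc less_Suc_eq)
  have "x \<notin> elts x" for x :: 'v
    using wf_not_refl[OF foundation] by auto
  with mem have "inj f"
    by (metis injI linorder_neq_iff)
  ultimately show ?thesis using that by blast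
qed

instance mform :: (countable) countable
  by countable_datatype

text \<open>Prepares the move of canonical states, which are sets of formulas, into the universe:
  they are coded as subsets of a copy of the natural numbers, hence inside one power set.
  Countability of the language enters here.\<close>

lemma inj_set_of_countable:
  obtains g :: "'c::countable set \<Rightarrow> 'v::zfc" where "inj g" "is_set (range g)"
proof -
  obtain f :: "nat \<Rightarrow> 'v" where f: "inj f" "is_set (range f)"
    by (rule omega_inj)
  have set: "is_set (f ` to_nat ` A)" for A :: "'c set"
    using f(2) by (rule is_set_subset) auto
  define g where "g A = vset (f ` to_nat ` A)" for A :: "'c set"
  have "inj g"
    by (rule injI) (simp add: g_def vset_inject set inj_image_eq_iff f(1))
  moreover have "is_set (range g)"
    by (rule is_set_subset[OF is_set_Pow[OF f(2)]]) (auto simp: g_def elts_vset_is_set[OF set])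
  ultimately show ?thesis by (rule that)
qed

section \<open>Every element of the algebra is the value of a sentence\<close>

lemma vdom_empty: "vdom (vset {}) = {}"
  by (simp add: vdom_def elts_vset_is_set)

lemma vdom_single: "vdom (vset {vpair x y}) = {x}"
  by (auto simp: vdom_def elts_vset_is_set)

lemma vapp_single: "vapp (vset {vpair x y}) x = y"
  by (simp add: vapp_def elts_vset_is_set)

lemma vset_empty_in_stage: "\<xi> \<in> elts \<alpha> \<Longrightarrow> vset {} \<in> stage B \<alpha>"
  by (subst stage.simps) (auto simp: vfunction_def vran_def vdom_def elts_vset_is_set)

lemma vset_single_in_stage:
  "x \<in> stage B \<xi> \<Longrightarrow> \<xi> \<in> elts \<alpha> \<Longrightarrow> b \<in> carrier B \<Longrightarrow> vset {vpair x b} \<in> stage B \<alpha>"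
  by (subst stage.simps) (auto simp: vfunction_def vran_def vdom_def elts_vset_is_set)

text \<open>Stage zero is empty, so the empty function appears at ordinal 1 and the singleton
  function on it at ordinal 2; these two ordinals are exhibited directly.\<close>

lemma vset_names:
  fixes B :: "'v::zfc gorder"
  shows "vset {} \<in> names B"
    and "b \<in> carrier B \<Longrightarrow> vset {vpair (vset {}) b} \<in> names B"
proof -
  let ?zero = "vset {} :: 'v"
  let ?one = "vset {?zero}"
  let ?two = "vset {?zero, ?one}"
  have elts: "elts ?zero = {}" "elts ?one = {?zero}" "elts ?two = {?zero, ?one}"
    by (auto simp: elts_vset_is_set)
  have ord: "vordinal ?one" "vordinal ?two"
    unfolding vordinal_def vtransitive_def by (auto simp: elts)
  have zero: "?zero \<in> stage B ?one"
    by (rule vset_empty_in_stage[of ?zero]) (simp add: elts)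
  with ord show "vset {} \<in> names B"
    unfolding names_def by blast
  assume "b \<in> carrier B"
  then have "vset {vpair ?zero b} \<in> stage B ?two"
    by (intro vset_single_in_stage[OF zero]) (simp_all add: elts)
  with ord show "vset {vpair ?zero b} \<in> names B"
    unfolding names_def by blast
qed

definition value_sent :: "'v::zfc \<Rightarrow> 'v sform" where
  "value_sent b = SMem (SConst (vset {})) (SConst (vset {vpair (vset {}) b}))"

lemma value_sent_Sent: "b \<in> carrier B \<Longrightarrow> value_sent b \<in> Sent B"
  by (simp add: value_sent_def Sent_def vset_names)

text \<open>The join runs over one name and reduces to the meet of \<open>b\<close> with the value
  of the equation between empty names, which is top because both infima in it are empty.\<close>

lemma bval_value_sent:
  fixes B :: "'v::zfc gorder"
  assumes "complete_boolean_alg B" "b \<in> carrier B"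
  shows "bval B (value_sent b) = b"
proof -
  interpret complete_boolean_alg B by fact
  have top: "\<Sqinter>\<^bsub>B\<^esub>{} = \<top>\<^bsub>B\<^esub>"
    using weak_inf_empty by (simp add: eq_is_equal)
  have "\<top>\<^bsub>B\<^esub> \<sqinter>\<^bsub>B\<^esub> \<top>\<^bsub>B\<^esub> = \<top>\<^bsub>B\<^esub>"
    using top_meet[of "\<top>\<^bsub>B\<^esub>"] by (simp add: eq_is_equal)
  then have "val_eq B (vset {}) (vset {}) = \<top>\<^bsub>B\<^esub>"
    by (simp add: val_eq.simps vdom_empty infi_def top)
  moreover have "b \<sqinter>\<^bsub>B\<^esub> \<top>\<^bsub>B\<^esub> = b"
    using top_meet[of b] assms(2) by (simp add: eq_is_equal meet_comm)
  ultimately show ?thesis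
    using assms(2)
    by (simp add: value_sent_def val_mem.simps vdom_single vapp_single supr_def)
qed

section \<open>Reflexive symmetric models as translation models\<close>

definition pow_alg :: "'v::zfc \<Rightarrow> 'v gorder" where
  "pow_alg X = \<lparr>carrier = {y. elts y \<subseteq> elts X}, eq = (=), le = (\<lambda>x y. elts x \<subseteq> elts y)\<rparr>"

lemma pow_alg_simps [simp]:
  "carrier (pow_alg X) = {y. elts y \<subseteq> elts X}"
  "eq (pow_alg X) = (=)"
  "x \<sqsubseteq>\<^bsub>pow_alg X\<^esub> y \<longleftrightarrow> elts x \<subseteq> elts y"
  by (simp_all add: pow_alg_def)

lemma elts_vset_subset: "A \<subseteq> elts X \<Longrightarrow> elts (vset A) = A"
  by (rule elts_vset_is_set[OF is_set_subset[OF is_set_elts]])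

lemma complete_lattice_pow_alg: "complete_lattice (pow_alg X)"
proof -
  interpret partial_order "pow_alg X"
    by unfold_locales (auto intro: extensionality)
  show ?thesis
  proof
    fix A assume A: "A \<subseteq> carrier (pow_alg X)"
    \<comment> \<open>Comprehension inside \<open>elts X\<close> makes the infimum of the empty
      family \<open>X\<close>. Both extensions are bounded by \<open>X\<close>, hence sets, although
      \<open>A\<close> is an arbitrary class.\<close>
    let ?s = "vset (\<Union>a\<in>A. elts a)" and ?i = "vset {x \<in> elts X. \<forall>a\<in>A. x \<in> elts a}"
    have "elts ?s = (\<Union>a\<in>A. elts a)"
      using A by (intro elts_vset_subset[of _ X]) auto
    with A have "least (pow_alg X) ?s (Upper (pow_alg X) A)"
      by (intro least_UpperI) (fastforce simp: Upper_def)+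
    then show "\<exists>s. least (pow_alg X) s (Upper (pow_alg X) A)" ..
    have "elts ?i = {x \<in> elts X. \<forall>a\<in>A. x \<in> elts a}"
      by (intro elts_vset_subset[of _ X]) auto
    with A have "greatest (pow_alg X) ?i (Lower (pow_alg X) A)"
      by (intro greatest_LowerI) (fastforce simp: Lower_def)+
    then show "\<exists>i. greatest (pow_alg X) i (Lower (pow_alg X) A)" ..
  qed
qed

text \<open>Meet and join are known only as extremal bounds, so intersection and union are compared
  with them in both directions.\<close>

lemma elts_pow_alg:
  assumes "elts x \<subseteq> elts X" "elts y \<subseteq> elts X"
  shows elts_meet: "elts (x \<sqinter>\<^bsub>pow_alg X\<^esub> y) = elts x \<inter> elts y"
    and elts_join: "elts (x \<squnion>\<^bsub>pow_alg X\<^esub> y) = elts x \<union> elts y"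
proof -
  interpret complete_lattice "pow_alg X" by (rule complete_lattice_pow_alg)
  have eq: "elts (vset (elts x \<inter> elts y)) = elts x \<inter> elts y"
    "elts (vset (elts x \<union> elts y)) = elts x \<union> elts y"
    using assms by (auto intro!: elts_vset_subset[of _ X])
  show "elts (x \<sqinter>\<^bsub>pow_alg X\<^esub> y) = elts x \<inter> elts y"
    using meet_left[of x y] meet_right[of x y] meet_le[of "vset (elts x \<inter> elts y)" x y] assms eq
    by auto
  show "elts (x \<squnion>\<^bsub>pow_alg X\<^esub> y) = elts x \<union> elts y"
    using join_left[of x y] join_right[of x y] join_le[of x "vset (elts x \<union> elts y)" y] assms eq
    by auto
qed

lemma elts_bottom: "elts (\<bottom>\<^bsub>pow_alg X\<^esub>) = {}"
proof -
  interpret complete_lattice "pow_alg X" by (rule complete_lattice_pow_alg)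
  show ?thesis
    using bottom_lower[of "vset {}"] by (auto simp: elts_vset_is_set)
qed

lemma elts_top: "elts (\<top>\<^bsub>pow_alg X\<^esub>) = elts X"
proof -
  interpret complete_lattice "pow_alg X" by (rule complete_lattice_pow_alg)
  show ?thesis
    using top_higher[of X] top_closed by auto
qed

lemma complete_boolean_alg_pow_alg: "complete_boolean_alg (pow_alg X)"
proof -
  interpret complete_lattice "pow_alg X" by (rule complete_lattice_pow_alg)
  show ?thesis
  proof
    fix x y z assume *: "x \<in> carrier (pow_alg X)" "y \<in> carrier (pow_alg X)" "z \<in> carrier (pow_alg X)"
    then show "x \<sqinter>\<^bsub>pow_alg X\<^esub> (y \<squnion>\<^bsub>pow_alg X\<^esub> z) =
        (x \<sqinter>\<^bsub>pow_alg X\<^esub> y) \<squnion>\<^bsub>pow_alg X\<^esub> (x \<sqinter>\<^bsub>pow_alg X\<^esub> z)"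
      by (intro extensionality) (simp add: elts_meet elts_join le_infI1 Int_Un_distrib)
  next
    fix x assume x: "x \<in> carrier (pow_alg X)"
    have "elts (vset (elts X - elts x)) = elts X - elts x"
      by (rule elts_vset_subset) auto
    with x show "\<exists>y\<in>carrier (pow_alg X). x \<sqinter>\<^bsub>pow_alg X\<^esub> y = \<bottom>\<^bsub>pow_alg X\<^esub> \<and> x \<squnion>\<^bsub>pow_alg X\<^esub> y = \<top>\<^bsub>pow_alg X\<^esub>"
      by (intro bexI[of _ "vset (elts X - elts x)"] conjI extensionality)
        (auto simp: elts_meet elts_join elts_bottom elts_top)
  qed
qed

section \<open>Realizing reflexive symmetric models by overlap\<close>

text \<open>A map onto the states that preserves and reflects accessibility is a bounded
  morphism.\<close>

lemma sat_transfer: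
  assumes states: "states N = f ` states M"
    and acc: "\<And>a b. a \<in> states M \<Longrightarrow> b \<in> states M \<Longrightarrow> acc N (f a) (f b) \<longleftrightarrow> acc M a b"
    and val: "\<And>a p. a \<in> states M \<Longrightarrow> val N (f a) p \<longleftrightarrow> val M a p"
  shows "a \<in> states M \<Longrightarrow> sat N (f a) \<phi> \<longleftrightarrow> sat M a \<phi>"
  by (induction \<phi> arbitrary: a) (auto simp: states acc val)

text \<open>A state is sent to the set of its incident edges, an edge being an unordered pair of related
  states. Two states share an edge iff they are related, and the loop at a state \<open>w\<close>, present by
  reflexivity, belongs to the image of \<open>w\<close> only.\<close>

lemma reflexive_symmetric_translation_model:
  fixes M :: "('w, 'p) kripke_model" and g :: "'w \<Rightarrow> 'v::zfc"
  assumes refl: "\<And>a. a \<in> states M \<Longrightarrow> acc M a a"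
    and sym: "\<And>a b. a \<in> states M \<Longrightarrow> b \<in> states M \<Longrightarrow> acc M a b \<Longrightarrow> acc M b a"
    and inj: "inj g" and set: "is_set (range g)"
  obtains B :: "'v gorder" and W T f where
    "complete_boolean_alg B" "is_set (carrier B)" "W \<subseteq> positive B" "translation B T"
    "W = f ` states M"
    "\<forall>a\<in>states M. \<forall>\<phi>. sat (translation_model B W T) (f a) \<phi> \<longleftrightarrow> sat M a \<phi>"
proof -
  \<comment> \<open>This power set contains every unordered pair of codes of states. Edges are thus
    elements of \<open>X\<close>, and sets of edges are elements of the algebra.\<close>
  define X where "X = vset {y. elts y \<subseteq> range g}"
  have X: "elts X = {y. elts y \<subseteq> range g}"
    unfolding X_def by (intro elts_vset_is_set is_set_Pow set)
  define edge where "edge a b = vset {g a, g b}" for a b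
  have edge_X: "edge a b \<in> elts X" for a b
    by (simp add: edge_def X elts_vset_is_set)
  have edge_eq: "edge a b = edge c d \<longleftrightarrow> a = c \<and> b = d \<or> a = d \<and> b = c" for a b c d
    unfolding edge_def using inj by (simp add: vset_inject doubleton_eq_iff inj_eq)
  define f where "f a = vset {edge a b |b. b \<in> states M \<and> acc M a b}" for a
  have f: "elts (f a) = {edge a b |b. b \<in> states M \<and> acc M a b}" for a
    unfolding f_def by (rule elts_vset_subset[of _ X]) (auto simp: edge_X)
  \<comment> \<open>The intended value of \<open>p\<close>: the join of the images of the states
    satisfying \<open>p\<close>.\<close>
  define U where "U p = vset (\<Union>a\<in>{a \<in> states M. val M a p}. elts (f a))" for p
  have U: "elts (U p) = (\<Union>a\<in>{a \<in> states M. val M a p}. elts (f a))" for p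
    unfolding U_def by (rule elts_vset_subset[of _ X]) (auto simp: f edge_X)
  define B where "B = pow_alg X"
  have cba: "complete_boolean_alg B"
    unfolding B_def by (rule complete_boolean_alg_pow_alg)
  have f_B: "elts (f a) \<subseteq> elts X" for a
    by (auto simp: f edge_X)
  have U_B: "U p \<in> carrier B" for p
    using f_B by (auto simp: B_def U)
  have loop: "edge a a \<in> elts (f b) \<longleftrightarrow> a = b" if "a \<in> states M" for a b
    using that refl by (auto simp: f edge_eq)
  let ?T = "\<lambda>p. value_sent (U p)"
  let ?N = "translation_model B (f ` states M) ?T"
  show ?thesis
  proof
    show "complete_boolean_alg B" by fact
    show "is_set (carrier B)"
      unfolding B_def using is_set_Pow[of "elts X"] by simp
    show "f ` states M \<subseteq> positive B"
    proof (rule image_subsetI)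
      fix a assume "a \<in> states M"
      then have "elts (f a) \<noteq> {}" using loop by blast
      then show "f a \<in> positive B" using f_B[of a] by (auto simp: positive_def B_def elts_bottom)
    qed
    show "translation B ?T"
      unfolding translation_def using U_B value_sent_Sent by blast
    show "\<forall>a\<in>states M. \<forall>\<phi>. sat ?N (f a) \<phi> \<longleftrightarrow> sat M a \<phi>"
    proof (intro ballI allI sat_transfer)
      show "states ?N = f ` states M"
        by (simp add: translation_model_def)
      fix a assume a: "a \<in> states M"
      {
        fix b assume b: "b \<in> states M"
        have "acc ?N (f a) (f b) \<longleftrightarrow> elts (f a \<sqinter>\<^bsub>B\<^esub> f b) \<noteq> elts \<bottom>\<^bsub>B\<^esub>"
          unfolding translation_model_def using extensionality by auto
        also have "\<dots> \<longleftrightarrow> elts (f a) \<inter> elts (f b) \<noteq> {}"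
          unfolding B_def by (simp add: elts_meet f_B elts_bottom)
        also have "\<dots> \<longleftrightarrow> acc M a b"
        proof
          assume "elts (f a) \<inter> elts (f b) \<noteq> {}"
          \<comment> \<open>Equal unordered pairs leave two cases: \<open>a = b\<close>, settled by
            reflexivity, or \<open>c = b\<close>, where \<open>acc M a c\<close> is the
            claim.\<close>
          then obtain c d where "edge a c = edge b d" "acc M a c"
            unfolding f by blast
          then show "acc M a b" using refl[OF a] by (auto simp: edge_eq)
        next
          assume "acc M a b"
          \<comment> \<open>Symmetry makes the same edge incident to \<open>b\<close> as
            well.\<close>
          then have "edge a b \<in> elts (f a)" "edge b a \<in> elts (f b)"
            using a b sym[OF a b] unfolding f by blast+
          moreover have "edge a b = edge b a" by (simp add: edge_eq)
          ultimately show "elts (f a) \<inter> elts (f b) \<noteq> {}" by auto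
        qed
        finally show "acc ?N (f a) (f b) \<longleftrightarrow> acc M a b" .
      }
      fix p
      have "val ?N (f a) p \<longleftrightarrow> elts (f a) \<subseteq> elts (U p)"
        by (simp add: translation_model_def bval_value_sent[OF cba U_B]) (simp add: B_def)
      also have "\<dots> \<longleftrightarrow> val M a p"
      proof
        assume "elts (f a) \<subseteq> elts (U p)"
        \<comment> \<open>The loop at \<open>a\<close> comes from the image of some state satisfying
          \<open>p\<close>, and that state can only be \<open>a\<close>.\<close>
        then have "edge a a \<in> elts (U p)" using loop[OF a, of a] by blast
        then show "val M a p" using loop[OF a] by (auto simp: U)
      qed (use a in \<open>auto simp: U\<close>)
      finally show "val ?N (f a) p \<longleftrightarrow> val M a p" .
    qed
  qed simp
qed

text \<open>Subsets of \<open>'v\<close> are classes, so the carrier is required to be a set;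
  \<open>W\<close>, being included in it, is then a set by separation.\<close>

theorem theorem5p3:
  fixes \<phi> :: "'p::countable mform"
  shows "\<phi> \<in> KTB \<longleftrightarrow>
    (\<forall>(B :: 'v::zfc gorder) W T.
       complete_boolean_alg B \<and> is_set (carrier B) \<and>
       W \<noteq> {} \<and> W \<subseteq> positive B \<and> translation B T \<longrightarrow>
       holds_in (translation_model B W T) \<phi>)"
    (is "_ \<longleftrightarrow> ?valid")
proof
  assume \<phi>: "\<phi> \<in> KTB"
  show ?valid
  proof (intro allI impI, elim conjE)
    fix B :: "'v gorder" and W T
    assume "complete_boolean_alg B" and W: "W \<subseteq> positive B"
    then interpret complete_boolean_alg B by blast
    have idem: "a \<sqinter>\<^bsub>B\<^esub> a = a" if "a \<in> carrier B" for a
      using that by (simp add: meet_def)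
    show "holds_in (translation_model B W T) \<phi>"
      using W by (intro KTB_sound[OF \<phi>])
        (auto simp: translation_model_def positive_def idem subset_iff meet_comm)
  qed
next
  assume valid: ?valid
  show "\<phi> \<in> KTB"
  proof (rule ccontr)
    assume "\<phi> \<notin> KTB"
    then obtain \<Gamma> where \<Gamma>: "\<Gamma> \<in> states canonical" "\<not> sat canonical \<Gamma> \<phi>"
      by (rule canonical_complete)
    obtain g :: "'p mform set \<Rightarrow> 'v" where g: "inj g" "is_set (range g)"
      by (rule inj_set_of_countable)
    obtain B :: "'v gorder" and W T and f :: "'p mform set \<Rightarrow> 'v" where
      model: "complete_boolean_alg B" "is_set (carrier B)" "W \<subseteq> positive B" "translation B T"
      and W: "W = f ` states canonical"
      and sat: "\<forall>a\<in>states canonical. \<forall>\<phi>.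
        sat (translation_model B W T) (f a) \<phi> \<longleftrightarrow> sat canonical a \<phi>"
      by (rule reflexive_symmetric_translation_model[OF canonical_refl canonical_sym g])
    have "W \<noteq> {}" using W \<Gamma>(1) by blast
    with model have "holds_in (translation_model B W T) \<phi>"
      by (intro valid[rule_format] conjI)
    with \<Gamma> W sat show False
      by (simp add: holds_in_def translation_model_def)
  qed
qed

end
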